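(* Let $G$ be a $4$-chromatic maximal planar graph with $\delta(G)\ge 4$, let $f\in C_4^0(G)$, and let $C$ be a bichromatic cycle of $f$. Then $C$ is an unchanged bichromatic cycle (UB-cycle) of $f$ if and only if for every cycle $C'\in C^2(F^f)$ with $f(C')\neq f(C)$, the cycles $C$ and $C'$ are nonintersecting.
   Context: $G$ is considered with a fixed plane embedding. Colours are $\{1,2,3,4\}$; $C_4^0(G)$ is the set of proper $4$-colourings of $G$, where two colourings differing only by a permutation of colour names are identified. For a colouring $f$ and a subgraph $H$, $f(H)=\{f(v): v\in V(H)\}$. A bichromatic cycle of $f$ is a cycle $C$ with $|f(C)|=2$; $C^2(f)$ denotes the set of bichromatic cycles of $f$. For a bichromatic cycle $C$ of $f$ with $f(C)=\{i,j\}$ and $\{s,t\}=\{1,2,3,4\}\setminus\{i,j\}$, the $\sigma$-operation $\sigma(f,C)$ produces the colouring obtained from $f$ by interchanging colours $s$ and $t$ on all vertices lying in the interior (bounded side) of $C$. Two colourings are Kempe-equivalent if one is obtained from the other by a finite sequence of $\sigma$-operations; $F^f(G)\subseteq C_4^0(G)$ is the Kempe-equivalence class of $f$, and $C^2(F^f)=\bigcup_{f'\in F^f(G)} C^2(f')$. A bichromatic cycle $C$ of $f$ is an unchanged bichromatic cycle (UB-cycle) of $f$ if $|f'(C)|=2$ for every $f'\in F^f(G)$. Two cycles $C_1,C_2$ are intersecting if $V(C_1)$ contains a vertex in the interior of $C_2$ and $V(C_2)$ contains a vertex in the interior of $C_1$; otherwise they are nonintersecting.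
   Formalization: The condition f(C') ≠ f(C) is replaced by f'(C') ≠ f'(C), read in every colouring f' of F^f for which C' is a bichromatic cycle; with colours read in the initial f the claim is false (a UB-cycle may intersect a C' that is 3-coloured in f). *)

theory Defs
  imports "HOL-Analysis.Analysis" "HOL-Combinatorics.Permutations"
begin

record 'a ugraph =
  verts :: "'a set"
  edges :: "'a set set"

definition simple_graph :: "'a ugraph \<Rightarrow> bool" where
  "simple_graph G \<longleftrightarrow> finite (verts G) \<and> (\<forall>e\<in>edges G. e \<subseteq> verts G \<and> card e = 2)"

definition degree :: "'a ugraph \<Rightarrow> 'a \<Rightarrow> nat" where
  "degree G v = card {e \<in> edges G. v \<in> e}"

text \<open>Meaningful for graphs with a finite nonempty vertex set only.\<close>
definition min_degree :: "'a ugraph \<Rightarrow> nat" where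
  "min_degree G = Min (degree G ` verts G)"

text \<open>Drawings in the plane: vertices are points, edges are arcs, and distinct edges meet in
  common endpoints only.\<close>

record 'a drawing =
  pos :: "'a \<Rightarrow> complex"
  curve :: "'a set \<Rightarrow> real \<Rightarrow> complex"

definition plane_embedding :: "'a ugraph \<Rightarrow> 'a drawing \<Rightarrow> bool" where
  "plane_embedding G \<Phi> \<longleftrightarrow>
     inj_on (pos \<Phi>) (verts G) \<and>
     (\<forall>e\<in>edges G. arc (curve \<Phi> e) \<and>
        {pathstart (curve \<Phi> e), pathfinish (curve \<Phi> e)} = pos \<Phi> ` e) \<and>
     (\<forall>e\<in>edges G. \<forall>v\<in>verts G. pos \<Phi> v \<in> path_image (curve \<Phi> e) \<longrightarrow> v \<in> e) \<and>
     (\<forall>e\<in>edges G. \<forall>e'\<in>edges G. e \<noteq> e' \<longrightarrow>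
        path_image (curve \<Phi> e) \<inter> path_image (curve \<Phi> e') \<subseteq> pos \<Phi> ` (e \<inter> e'))"

definition planar :: "'a ugraph \<Rightarrow> bool" where
  "planar G \<longleftrightarrow> simple_graph G \<and> (\<exists>\<Phi>. plane_embedding G \<Phi>)"

definition maximal_planar :: "'a ugraph \<Rightarrow> bool" where
  "maximal_planar G \<longleftrightarrow> planar G \<and>
     (\<forall>u\<in>verts G. \<forall>v\<in>verts G. u \<noteq> v \<and> {u, v} \<notin> edges G \<longrightarrow>
        \<not> planar (G\<lparr>edges := insert {u, v} (edges G)\<rparr>))"

text \<open>A cycle is given by the list of its vertices in cyclic order; the lists obtained from it by
  rotation and reversal describe the same cycle.\<close>

definition cycle_edges :: "'a list \<Rightarrow> 'a set set" where
  "cycle_edges C = {{C ! i, C ! (Suc i mod length C)} | i. i < length C}"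

definition is_cycle :: "'a ugraph \<Rightarrow> 'a list \<Rightarrow> bool" where
  "is_cycle G C \<longleftrightarrow>
     3 \<le> length C \<and> distinct C \<and> set C \<subseteq> verts G \<and> cycle_edges C \<subseteq> edges G"

definition cycle_image :: "'a drawing \<Rightarrow> 'a list \<Rightarrow> complex set" where
  "cycle_image \<Phi> C = (\<Union>e\<in>cycle_edges C. path_image (curve \<Phi> e))"

definition interior_verts :: "'a ugraph \<Rightarrow> 'a drawing \<Rightarrow> 'a list \<Rightarrow> 'a set" where
  "interior_verts G \<Phi> C = {v \<in> verts G. pos \<Phi> v \<in> inside (cycle_image \<Phi> C)}"

definition intersecting :: "'a ugraph \<Rightarrow> 'a drawing \<Rightarrow> 'a list \<Rightarrow> 'a list \<Rightarrow> bool" where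
  "intersecting G \<Phi> C1 C2 \<longleftrightarrow>
     set C1 \<inter> interior_verts G \<Phi> C2 \<noteq> {} \<and> set C2 \<inter> interior_verts G \<Phi> C1 \<noteq> {}"

definition proper_colourings :: "'a ugraph \<Rightarrow> nat set \<Rightarrow> ('a \<Rightarrow> nat) set" where
  "proper_colourings G K =
     {f \<in> verts G \<rightarrow>\<^sub>E K. \<forall>u v. {u, v} \<in> edges G \<longrightarrow> f u \<noteq> f v}"

definition chromatic_number :: "'a ugraph \<Rightarrow> nat" where
  "chromatic_number G = (LEAST k. proper_colourings G {..<k} \<noteq> {})"

definition colours :: "nat set" where
  "colours = {1, 2, 3, 4}"

text \<open>The set of bichromatic cycles of \<open>f\<close>.\<close>
definition bichromatic_cycles :: "'a ugraph \<Rightarrow> ('a \<Rightarrow> nat) \<Rightarrow> 'a list set" where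
  "bichromatic_cycles G f = {C. is_cycle G C \<and> card (f ` set C) = 2}"

definition swap_inside ::
    "'a ugraph \<Rightarrow> 'a drawing \<Rightarrow> 'a list \<Rightarrow> nat \<Rightarrow> nat \<Rightarrow> ('a \<Rightarrow> nat) \<Rightarrow> 'a \<Rightarrow> nat" where
  "swap_inside G \<Phi> C s t f =
     (\<lambda>v. if v \<in> interior_verts G \<Phi> C then Transposition.transpose s t (f v) else f v)"

text \<open>Four-colourings that differ by a permutation of the colours are identified. An identified
  colouring is represented here by any of its members, so the Kempe class is closed under renaming
  of colours (rule \<open>rename\<close>) besides the \<open>\<sigma>\<close>-operation (rule \<open>sigma\<close>).\<close>

inductive_set kempe_class ::
    "'a ugraph \<Rightarrow> 'a drawing \<Rightarrow> ('a \<Rightarrow> nat) \<Rightarrow> ('a \<Rightarrow> nat) set"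
  for G :: "'a ugraph" and \<Phi> :: "'a drawing" and f :: "'a \<Rightarrow> nat" where
  base: "f \<in> kempe_class G \<Phi> f"
| sigma: "\<lbrakk>g \<in> kempe_class G \<Phi> f; C \<in> bichromatic_cycles G g; {s, t} = colours - g ` set C\<rbrakk>
    \<Longrightarrow> swap_inside G \<Phi> C s t g \<in> kempe_class G \<Phi> f"
| rename: "\<lbrakk>g \<in> kempe_class G \<Phi> f; p permutes colours\<rbrakk>
    \<Longrightarrow> restrict (p \<circ> g) (verts G) \<in> kempe_class G \<Phi> f"

definition UB_cycle :: "'a ugraph \<Rightarrow> 'a drawing \<Rightarrow> ('a \<Rightarrow> nat) \<Rightarrow> 'a list \<Rightarrow> bool" where
  "UB_cycle G \<Phi> f C \<longleftrightarrow>
     C \<in> bichromatic_cycles G f \<and> (\<forall>f'\<in>kempe_class G \<Phi> f. card (f' ` set C) = 2)"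

end

theory Submission
  imports Defs
begin

text \<open>Let \<open>C\<close> and \<open>C'\<close> be bichromatic cycles of \<open>g\<close> with different colour sets, and let \<open>h\<close> be
  the result of the \<open>\<sigma>\<close>-operation on \<open>C'\<close>. No edge lies on both cycles, and \<open>C\<close> is bichromatic
  under \<open>h\<close> iff it does not have vertices strictly on both sides of \<open>C'\<close>. By the Jordan curve
  theorem, if \<open>C\<close> stays weakly inside \<open>C'\<close>, then \<open>C'\<close> has no vertex inside \<open>C\<close>; and if \<open>C'\<close> has no
  vertex inside \<open>C\<close>, then the connected region inside \<open>C\<close> lies on one side of \<open>C'\<close>, and so
  weakly does its frontier \<open>C\<close>.\<close>

section \<open>Jordan curves\<close>

definition jordan_curve :: "complex set \<Rightarrow> bool" where
  "jordan_curve J \<longleftrightarrow> (\<exists>c. simple_path c \<and> pathfinish c = pathstart c \<and> path_image c = J)"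

text \<open>The closure identities hold because \<open>J\<close> is the frontier of both regions.
  They are what carries an inclusion between regions over to the curves bounding them.\<close>

lemma jordan_curve_sides:
  assumes "jordan_curve J"
  shows "closed J" "connected J"
    "open (inside J)" "connected (inside J)" "bounded (inside J)"
    "open (outside J)" "connected (outside J)" "\<not> bounded (outside J)"
    "inside J \<inter> outside J = {}" "inside J \<union> outside J = - J"
    "closure (inside J) = inside J \<union> J" "closure (outside J) = outside J \<union> J"
proof -
  obtain c where c: "simple_path c" "pathfinish c = pathstart c" "path_image c = J"
    using assms by (auto simp: jordan_curve_def)
  note J = Jordan_inside_outside[OF c(1,2), unfolded c(3)]
  show "closed J"
    using c closed_path_image simple_path_imp_path by blast
  show "connected J"
    using c connected_path_image simple_path_imp_path by blast
  show "open (inside J)" "connected (inside J)" "bounded (inside J)"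
    "open (outside J)" "connected (outside J)" "\<not> bounded (outside J)"
    "inside J \<inter> outside J = {}" "inside J \<union> outside J = - J"
    using J by auto
  show "closure (inside J) = inside J \<union> J" "closure (outside J) = outside J \<union> J"
    using J by (metis closure_Un_frontier)+
qed

lemma connected_one_side:
  assumes "jordan_curve J" "connected A" "A \<inter> J = {}"
  shows "A \<subseteq> inside J \<or> A \<subseteq> outside J"
proof -
  note J = jordan_curve_sides[OF assms(1)]
  have "A \<subseteq> inside J \<union> outside J"
    using J(10) assms(3) by auto
  then show ?thesis
    using connectedD[OF assms(2) J(3,6)] J(9) by blast
qed

text \<open>The region outside \<open>J'\<close> is connected and misses \<open>J\<close>, so it
  lies on one side of \<open>J\<close>. Being unbounded, it does not fit into
  \<open>inside J\<close>, so it lies in \<open>outside J\<close>; passing to closures puts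
  \<open>J'\<close> weakly outside \<open>J\<close>.\<close>

lemma weakly_inside_disjoint_inside:
  assumes J: "jordan_curve J" and J': "jordan_curve J'" and sub: "J \<subseteq> inside J' \<union> J'"
  shows "J' \<inter> inside J = {}"
proof -
  note s = jordan_curve_sides[OF J] and s' = jordan_curve_sides[OF J']
  have "outside J' \<inter> J = {}"
    using sub s'(9,10) by blast
  moreover have "\<not> outside J' \<subseteq> inside J"
    using s(5) s'(8) bounded_subset by blast
  ultimately have "outside J' \<subseteq> outside J"
    using connected_one_side[OF J s'(7)] by blast
  then have "closure (outside J') \<subseteq> closure (outside J)"
    by (rule closure_mono)
  then show ?thesis
    using s(9,10,12) s'(12) by blast
qed

text \<open>Here the connected region \<open>inside J\<close> is the one that avoids the other
  curve. It lies on one side of \<open>J'\<close>, and its closure contains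
  \<open>J\<close>.\<close>

lemma weakly_outside_one_side:
  assumes J: "jordan_curve J" and J': "jordan_curve J'" and sub: "J' \<subseteq> outside J \<union> J"
  shows "J \<subseteq> inside J' \<union> J' \<or> J \<subseteq> outside J' \<union> J'"
proof -
  note s = jordan_curve_sides[OF J] and s' = jordan_curve_sides[OF J']
  have "inside J \<inter> J' = {}"
    using sub s(9,10) by blast
  then have "inside J \<subseteq> inside J' \<or> inside J \<subseteq> outside J'"
    using connected_one_side[OF J' s(4)] by blast
  then have "closure (inside J) \<subseteq> closure (inside J') \<or> closure (inside J) \<subseteq> closure (outside J')"
    using closure_mono by blast
  then show ?thesis
    using s(11) s'(11,12) by auto
qed

text \<open>Meant for an edge whose far end may lie on a cycle: without that end the curve is still
  connected, as the image of a half-open interval.\<close>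

lemma connected_arc_delete_finish:
  assumes "arc g"
  shows "connected (path_image g - {pathfinish g})"
proof -
  have inj: "inj_on g {0..1}" and cont: "continuous_on {0..1} g"
    using assms by (auto simp: arc_def path_def)
  have "path_image g - {pathfinish g} = g ` ({0..1} - {1})"
    using inj by (auto simp: path_image_def pathfinish_def inj_on_def)
  also have "{0..1::real} - {1} = {0..<1}"
    by auto
  also have "connected (g ` {0..<1})"
    by (intro connected_continuous_image continuous_on_subset[OF cont]) auto
  finally show ?thesis .
qed

section \<open>Cycles of an embedded graph\<close>

lemma cycle_edge_subset:
  assumes "e \<in> cycle_edges C"
  shows "e \<subseteq> set C"
proof -
  obtain i where i: "i < length C" "e = {C ! i, C ! (Suc i mod length C)}"
    using assms by (auto simp: cycle_edges_def)
  then have "Suc i mod length C < length C"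
    by (intro mod_less_divisor) auto
  then show ?thesis
    using i by auto
qed

lemma in_cycle_edge:
  assumes "v \<in> set C"
  obtains w where "{v, w} \<in> cycle_edges C" "w \<in> set C"
proof -
  obtain i where i: "i < length C" "v = C ! i"
    using assms by (auto simp: in_set_conv_nth)
  then have "Suc i mod length C < length C"
    by (intro mod_less_divisor) auto
  then show ?thesis
    using that[of "C ! (Suc i mod length C)"] i by (auto simp: cycle_edges_def)
qed

locale embedded_graph =
  fixes G :: "'a ugraph" and \<Phi> :: "'a drawing"
  assumes simple: "simple_graph G" and embedding: "plane_embedding G \<Phi>"
begin

section \<open>Joining edge curves to arcs and Jordan curves\<close>

lemma edge_verts: "{u, v} \<in> edges G \<Longrightarrow> u \<in> verts G \<and> v \<in> verts G \<and> u \<noteq> v"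
  using simple by (fastforce simp: simple_graph_def)

lemma curve_disjoint:
  assumes "e \<in> edges G" "e' \<in> edges G" "e \<noteq> e'"
  shows "path_image (curve \<Phi> e) \<inter> path_image (curve \<Phi> e') \<subseteq> pos \<Phi> ` (e \<inter> e')"
  using assms embedding unfolding plane_embedding_def by blast

lemma pos_on_curve:
  assumes "e \<in> edges G" "v \<in> verts G"
  shows "pos \<Phi> v \<in> path_image (curve \<Phi> e) \<longleftrightarrow> v \<in> e"
proof
  show "v \<in> e" if "pos \<Phi> v \<in> path_image (curve \<Phi> e)"
    using that assms embedding unfolding plane_embedding_def by blast
  assume "v \<in> e"
  moreover have "{pathstart (curve \<Phi> e), pathfinish (curve \<Phi> e)} = pos \<Phi> ` e"
    using assms(1) embedding by (simp add: plane_embedding_def)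
  ultimately have "pos \<Phi> v \<in> {pathstart (curve \<Phi> e), pathfinish (curve \<Phi> e)}"
    by simp
  then show "pos \<Phi> v \<in> path_image (curve \<Phi> e)"
    using pathstart_in_path_image[of "curve \<Phi> e"] pathfinish_in_path_image[of "curve \<Phi> e"]
    by (elim insertE) simp_all
qed

lemma pos_eq_iff: "u \<in> verts G \<Longrightarrow> v \<in> verts G \<Longrightarrow> pos \<Phi> u = pos \<Phi> v \<longleftrightarrow> u = v"
  using embedding by (auto simp: plane_embedding_def inj_on_eq_iff)

text \<open>\<open>plane_embedding\<close> fixes the ends of a curve only as an unordered pair, so
  the curve may have to be reversed before it can be joined to others.\<close>

lemma oriented_curve:
  assumes "{u, v} \<in> edges G"
  obtains g where "arc g" "pathstart g = pos \<Phi> u" "pathfinish g = pos \<Phi> v"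
    "path_image g = path_image (curve \<Phi> {u, v})"
proof -
  let ?c = "curve \<Phi> {u, v}"
  have c: "arc ?c" "{pathstart ?c, pathfinish ?c} = {pos \<Phi> u, pos \<Phi> v}"
    using embedding assms unfolding plane_embedding_def by auto
  then consider "pathstart ?c = pos \<Phi> u" "pathfinish ?c = pos \<Phi> v"
    | "pathstart ?c = pos \<Phi> v" "pathfinish ?c = pos \<Phi> u"
    by (auto simp: doubleton_eq_iff)
  then show ?thesis
  proof cases
    case 1
    then show ?thesis using that[of ?c] c by auto
  next
    case 2
    then show ?thesis using that[of "reversepath ?c"] c by (auto simp: arc_reversepath)
  qed
qed

lemma arc_of_path:
  assumes "n \<ge> 1" "distinct C" "n < length C" "\<And>i. i < n \<Longrightarrow> {C ! i, C ! Suc i} \<in> edges G"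
  shows "\<exists>g. arc g \<and> pathstart g = pos \<Phi> (C ! 0) \<and> pathfinish g = pos \<Phi> (C ! n) \<and>
    path_image g = (\<Union>i<n. path_image (curve \<Phi> {C ! i, C ! Suc i}))"
  using assms
proof (induction n rule: nat_induct_at_least)
  case base
  then show ?case
    using oriented_curve[of "C ! 0" "C ! 1"] by (auto simp: lessThan_Suc)
next
  case (Suc n)
  then obtain g where g: "arc g" "pathstart g = pos \<Phi> (C ! 0)" "pathfinish g = pos \<Phi> (C ! n)"
    "path_image g = (\<Union>i<n. path_image (curve \<Phi> {C ! i, C ! Suc i}))"
    by auto
  have last: "{C ! n, C ! Suc n} \<in> edges G"
    using Suc.prems by auto
  then obtain h where h: "arc h" "pathstart h = pos \<Phi> (C ! n)" "pathfinish h = pos \<Phi> (C ! Suc n)"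
    "path_image h = path_image (curve \<Phi> {C ! n, C ! Suc n})"
    by (rule oriented_curve)
  \<comment> \<open>Vertices of \<open>C\<close> are distinct, so an earlier edge shares with the
    new one at most the junction \<open>C ! n\<close>, and distinct edges meet only in shared
    vertices.\<close>
  have "path_image (curve \<Phi> {C ! i, C ! Suc i}) \<inter> path_image (curve \<Phi> {C ! n, C ! Suc n})
      \<subseteq> {pos \<Phi> (C ! n)}" if "i < n" for i
  proof -
    have "{C ! i, C ! Suc i} \<inter> {C ! n, C ! Suc n} \<subseteq> {C ! n}"
      using that Suc.prems by (auto simp: nth_eq_iff_index_eq)
    moreover have "{C ! i, C ! Suc i} \<noteq> {C ! n, C ! Suc n}"
      using that Suc.prems by (auto simp: doubleton_eq_iff nth_eq_iff_index_eq)
    ultimately show ?thesis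
      using curve_disjoint[OF _ last, of "{C ! i, C ! Suc i}"] Suc.prems(3)[of i] that by fastforce
  qed
  then have "path_image g \<inter> path_image h \<subseteq> {pathstart h}"
    using g h by auto
  then have "arc (g +++ h)"
    using g h by (intro arc_join) auto
  moreover have "path_image (g +++ h) = (\<Union>i<Suc n. path_image (curve \<Phi> {C ! i, C ! Suc i}))"
    using g h by (subst path_image_join) (auto simp: lessThan_Suc)
  ultimately show ?case
    using g h by (intro exI[of _ "g +++ h"]) auto
qed

text \<open>The cycle is cut into the arc through all its vertices in list order and the closing
  edge from \<open>C ! n\<close> back to \<open>C ! 0\<close>; the two meet only in their
  ends.\<close>

lemma cycle_jordan_curve:
  assumes "is_cycle G C"
  shows "jordan_curve (cycle_image \<Phi> C)"
proof -
  define n where "n = length C - 1"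
  have len: "length C = Suc n" "n \<ge> 2" and dist: "distinct C"
    using assms by (auto simp: is_cycle_def n_def)
  have "{C ! i, C ! Suc i} \<in> cycle_edges C" if "i < n" for i
    using that len by (auto simp: cycle_edges_def intro!: exI[of _ i])
  then have E: "{C ! i, C ! Suc i} \<in> edges G" if "i < n" for i
    using that assms by (auto simp: is_cycle_def)
  have "{C ! n, C ! 0} \<in> cycle_edges C"
    using len by (auto simp: cycle_edges_def intro!: exI[of _ n])
  then have last: "{C ! n, C ! 0} \<in> edges G"
    using assms by (auto simp: is_cycle_def)
  obtain g where g: "arc g" "pathstart g = pos \<Phi> (C ! 0)" "pathfinish g = pos \<Phi> (C ! n)"
    "path_image g = (\<Union>i<n. path_image (curve \<Phi> {C ! i, C ! Suc i}))"
    using arc_of_path[of n C] len dist E by auto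
  obtain h where h: "arc h" "pathstart h = pos \<Phi> (C ! n)" "pathfinish h = pos \<Phi> (C ! 0)"
    "path_image h = path_image (curve \<Phi> {C ! n, C ! 0})"
    using last by (rule oriented_curve)
  have "path_image (curve \<Phi> {C ! i, C ! Suc i}) \<inter> path_image (curve \<Phi> {C ! n, C ! 0})
      \<subseteq> {pos \<Phi> (C ! 0), pos \<Phi> (C ! n)}" if "i < n" for i
  proof -
    have "i < length C" "Suc i < length C" "0 < length C" "n < length C"
      using that len by auto
    \<comment> \<open>Equality would force \<open>i = 0\<close> and \<open>n = 1\<close>, which
      length at least 3 excludes.\<close>
    then have "{C ! i, C ! Suc i} \<noteq> {C ! n, C ! 0}"
      using that len dist by (auto simp: doubleton_eq_iff nth_eq_iff_index_eq)
    then show ?thesis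
      using curve_disjoint[OF E[OF that] last] that len dist
      by (fastforce simp: nth_eq_iff_index_eq)
  qed
  then have "path_image g \<inter> path_image h \<subseteq> {pathstart g, pathstart h}"
    using g h by auto
  then have "simple_path (g +++ h)"
    using g h by (intro simple_path_join_loop) auto
  moreover have "path_image (g +++ h) = cycle_image \<Phi> C"
  proof -
    have "cycle_edges C = (\<lambda>i. {C ! i, C ! (Suc i mod length C)}) ` {..<Suc n}"
      using len by (auto simp: cycle_edges_def)
    also have "\<dots> = insert {C ! n, C ! 0} ((\<lambda>i. {C ! i, C ! Suc i}) ` {..<n})"
      using len by (auto simp: lessThan_Suc)
    finally have "cycle_image \<Phi> C = path_image g \<union> path_image h"
      using g h by (auto simp: cycle_image_def)
    then show ?thesis
      using g h by (subst path_image_join) auto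
  qed
  ultimately show ?thesis
    using g h unfolding jordan_curve_def by (intro exI[of _ "g +++ h"]) auto
qed

lemma curve_Int_cycle_image:
  assumes "is_cycle G C" "e \<in> edges G" "e \<notin> cycle_edges C"
  shows "path_image (curve \<Phi> e) \<inter> cycle_image \<Phi> C \<subseteq> pos \<Phi> ` (e \<inter> set C)"
proof -
  have "path_image (curve \<Phi> e) \<inter> path_image (curve \<Phi> e') \<subseteq> pos \<Phi> ` (e \<inter> set C)"
    if "e' \<in> cycle_edges C" for e'
  proof -
    have "e' \<in> edges G" "e' \<noteq> e" "e' \<subseteq> set C"
      using that assms cycle_edge_subset by (auto simp: is_cycle_def)
    then show ?thesis
      using curve_disjoint[of e e'] assms(2) by blast
  qed
  then show ?thesis
    unfolding cycle_image_def by blast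
qed

section \<open>Position of vertices, edges and cycles relative to a cycle\<close>

lemma pos_on_cycle:
  assumes "is_cycle G C" "v \<in> verts G"
  shows "pos \<Phi> v \<in> cycle_image \<Phi> C \<longleftrightarrow> v \<in> set C"
proof -
  have "pos \<Phi> v \<in> cycle_image \<Phi> C \<longleftrightarrow> v \<in> \<Union> (cycle_edges C)"
    using assms pos_on_curve by (fastforce simp: cycle_image_def is_cycle_def)
  then show ?thesis
    using cycle_edge_subset in_cycle_edge by (metis UnionE UnionI insertI1 subsetD)
qed

text \<open>Since \<open>u\<close> is off the cycle, the edge can touch it only at \<open>v\<close>;
  what remains after deleting that point is connected and stays on the side of \<open>u\<close>. The
  parameter \<open>S\<close> treats both sides at once.\<close>

lemma edge_one_side:
  assumes C: "is_cycle G C" and e: "{u, v} \<in> edges G"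
    and u: "u \<notin> set C" "pos \<Phi> u \<in> S (cycle_image \<Phi> C)"
    and S: "S = inside \<or> S = outside"
  shows "path_image (curve \<Phi> {u, v}) \<subseteq> S (cycle_image \<Phi> C) \<union> cycle_image \<Phi> C"
    and "v \<notin> set C \<Longrightarrow> pos \<Phi> v \<in> S (cycle_image \<Phi> C)"
proof -
  let ?J = "cycle_image \<Phi> C" and ?E = "path_image (curve \<Phi> {u, v})"
  have J: "jordan_curve ?J"
    by (rule cycle_jordan_curve[OF C])
  have uv: "u \<in> verts G" "v \<in> verts G" "u \<noteq> v"
    using edge_verts[OF e] by auto
  have in_E: "pos \<Phi> u \<in> ?E" "pos \<Phi> v \<in> ?E"
    using pos_on_curve[OF e] uv by auto
  have "{u, v} \<notin> cycle_edges C"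
    using u cycle_edge_subset by blast
  then have meet: "?E \<inter> ?J \<subseteq> pos \<Phi> ` ({v} \<inter> set C)"
    using curve_Int_cycle_image[OF C e] u by auto
  have side: "A \<subseteq> S ?J" if "connected A" "A \<inter> ?J = {}" "pos \<Phi> u \<in> A" for A
    using connected_one_side[OF J that(1,2)] jordan_curve_sides(9)[OF J] that(3) u(2) S by blast
  obtain g where g: "arc g" "pathfinish g = pos \<Phi> v" "path_image g = ?E"
    using oriented_curve[OF e] by metis
  show *: "pos \<Phi> v \<in> S ?J" if "v \<notin> set C"
  proof -
    have "?E \<inter> ?J = {}"
      using meet that by auto
    then have "?E \<subseteq> S ?J"
      using side in_E g connected_path_image[of g] arc_imp_path by metis
    then show ?thesis
      using in_E by auto
  qed
  have "?E - {pos \<Phi> v} \<subseteq> S ?J"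
  proof (rule side)
    show "connected (?E - {pos \<Phi> v})"
      using connected_arc_delete_finish[OF g(1)] g by simp
    show "(?E - {pos \<Phi> v}) \<inter> ?J = {}"
      using meet by auto
    show "pos \<Phi> u \<in> ?E - {pos \<Phi> v}"
      using in_E pos_eq_iff uv by auto
  qed
  moreover have "pos \<Phi> v \<in> S ?J \<union> ?J"
    using * pos_on_cycle[OF C uv(2)] by auto
  ultimately show "?E \<subseteq> S ?J \<union> ?J"
    by auto
qed

text \<open>The positions of the vertices would not determine the side of a chord of
  \<open>C'\<close>. Hypothesis \<open>E\<close> excludes chords: every edge of \<open>C\<close> has
  an end off \<open>C'\<close>, and that end decides its side.\<close>

lemma cycle_weakly_one_side:
  assumes C: "is_cycle G C" and C': "is_cycle G C'"
    and E: "\<And>e. e \<in> cycle_edges C \<Longrightarrow> \<not> e \<subseteq> set C'"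
    and S: "S = inside \<or> S = outside"
    and V: "\<And>v. v \<in> set C \<Longrightarrow> pos \<Phi> v \<in> S (cycle_image \<Phi> C') \<union> cycle_image \<Phi> C'"
  shows "cycle_image \<Phi> C \<subseteq> S (cycle_image \<Phi> C') \<union> cycle_image \<Phi> C'"
proof -
  have "path_image (curve \<Phi> e) \<subseteq> S (cycle_image \<Phi> C') \<union> cycle_image \<Phi> C'"
    if e: "e \<in> cycle_edges C" for e
  proof -
    have e': "e \<in> edges G" "e \<subseteq> set C"
      using e C cycle_edge_subset by (auto simp: is_cycle_def)
    obtain u where u: "u \<in> e" "u \<notin> set C'"
      using E[OF e] by auto
    have "card e = 2"
      using e' simple by (auto simp: simple_graph_def)
    then obtain v where v: "e = {u, v}"
      using u(1) by (auto simp: card_2_iff)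
    have "u \<in> verts G"
      using edge_verts e'(1) v by auto
    then have "pos \<Phi> u \<in> S (cycle_image \<Phi> C')"
      using V[of u] u e'(2) pos_on_cycle[OF C'] by auto
    then show ?thesis
      using edge_one_side(1)[OF C' _ u(2) _ S] e'(1) v by auto
  qed
  then show ?thesis
    by (auto simp: cycle_image_def)
qed

lemma interior_verts_iff:
  assumes "v \<in> verts G"
  shows "v \<in> interior_verts G \<Phi> C \<longleftrightarrow> pos \<Phi> v \<in> inside (cycle_image \<Phi> C)"
  using assms by (simp add: interior_verts_def)

lemma interior_vert_not_on_cycle:
  assumes "is_cycle G C" "v \<in> interior_verts G \<Phi> C"
  shows "v \<notin> set C"
  using assms pos_on_cycle[OF assms(1), of v] inside_no_overlap[of "cycle_image \<Phi> C"]
  unfolding interior_verts_def by blast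

text \<open>Hence a \<sigma>-operation on \<open>C\<close> swaps colours at both ends of such an
  edge or at neither.\<close>

lemma interior_edge:
  assumes C: "is_cycle G C" and e: "{u, v} \<in> edges G" and uv: "u \<notin> set C" "v \<notin> set C"
  shows "u \<in> interior_verts G \<Phi> C \<longleftrightarrow> v \<in> interior_verts G \<Phi> C"
proof -
  have "{v, u} \<in> edges G"
    using e by (simp add: insert_commute)
  then show ?thesis
    using edge_one_side(2)[OF C, where S = inside] edge_verts[OF e] e uv
    by (metis interior_verts_iff)
qed

section \<open>Colourings and \<open>\<sigma>\<close>-operations\<close>

lemma proper_edge:
  "g \<in> proper_colourings G K \<Longrightarrow> {u, v} \<in> edges G \<Longrightarrow> g u \<noteq> g v"
  by (auto simp: proper_colourings_def)

lemma swap_inside_eq: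
  assumes C: "is_cycle G C" and st: "{s, t} \<inter> g ` set C = {}"
  shows "v \<in> set C \<Longrightarrow> swap_inside G \<Phi> C s t g v = g v"
    and "v \<in> set C \<Longrightarrow> Transposition.transpose s t (g v) = g v"
  using st interior_vert_not_on_cycle[OF C]
  by (auto simp: swap_inside_def Transposition.transpose_def)

lemma swap_inside_proper:
  assumes g: "g \<in> proper_colourings G colours" and C: "is_cycle G C"
    and st: "{s, t} = colours - g ` set C"
  shows "swap_inside G \<Phi> C s t g \<in> proper_colourings G colours"
proof -
  let ?h = "swap_inside G \<Phi> C s t g" and ?I = "interior_verts G \<Phi> C"
  let ?p = "Transposition.transpose s t"
  have dis: "{s, t} \<inter> g ` set C = {}" and sub: "s \<in> colours" "t \<in> colours"
    using st by auto
  \<comment> \<open>Only vertices of \<open>G\<close> are interior, so the value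
    \<open>undefined\<close> off \<open>verts G\<close> is kept.\<close>
  have "?h \<in> verts G \<rightarrow>\<^sub>E colours"
    using g sub by (auto simp: proper_colourings_def PiE_iff extensional_def swap_inside_def
        interior_verts_def Transposition.transpose_def)
  moreover have "?h u \<noteq> ?h v" if e: "{u, v} \<in> edges G" for u v
  proof -
    have ne: "g u \<noteq> g v"
      using proper_edge[OF g e] .
    then have ne': "?p (g u) \<noteq> ?p (g v)"
      by (metis transpose_involutory)
    show ?thesis
    proof (cases "u \<in> set C \<or> v \<in> set C")
      case True
      \<comment> \<open>A colour on \<open>C\<close> is fixed by the transposition, so such an end
        may be read as swapped or as unswapped, whichever matches the other end.\<close>
      then show ?thesis
        using swap_inside_eq(2)[OF C dis] ne ne' by (metis swap_inside_def)
    next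
      case False
      then show ?thesis
        using interior_edge[OF C e] ne ne' by (auto simp: swap_inside_def)
    qed
  qed
  ultimately show ?thesis
    by (auto simp: proper_colourings_def)
qed

lemma kempe_class_proper:
  assumes "f \<in> proper_colourings G colours" "g \<in> kempe_class G \<Phi> f"
  shows "g \<in> proper_colourings G colours"
  using assms(2)
proof induction
  case base
  then show ?case by (rule assms(1))
next
  case (sigma g C s t)
  then show ?case
    using swap_inside_proper by (auto simp: bichromatic_cycles_def)
next
  case (rename g p)
  have "restrict (p \<circ> g) (verts G) \<in> verts G \<rightarrow>\<^sub>E colours"
    using rename by (auto simp: proper_colourings_def permutes_in_image)
  moreover have "restrict (p \<circ> g) (verts G) u \<noteq> restrict (p \<circ> g) (verts G) v"
    if "{u, v} \<in> edges G" for u v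
    using proper_edge[OF rename(3) that] edge_verts[OF that] permutes_inj[OF rename(2)]
    by (auto dest: injD)
  ultimately show ?case
    by (auto simp: proper_colourings_def)
qed

section \<open>Two bichromatic cycles with different colour sets\<close>

lemma edge_leaves_cycle:
  assumes g: "g \<in> proper_colourings G K" and C: "C \<in> bichromatic_cycles G g"
    and C': "C' \<in> bichromatic_cycles G g" and ne: "g ` set C \<noteq> g ` set C'"
    and e: "e \<in> cycle_edges C"
  shows "\<not> e \<subseteq> set C'"
proof
  assume sub: "e \<subseteq> set C'"
  have e': "e \<in> edges G" "e \<subseteq> set C"
    using e C cycle_edge_subset by (auto simp: is_cycle_def bichromatic_cycles_def)
  have "card e = 2"
    using e' simple by (auto simp: simple_graph_def)
  then obtain u v where uv: "e = {u, v}"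
    by (auto simp: card_2_iff)
  \<comment> \<open>A properly coloured edge already shows two colours, so it determines the colour
    set of every bichromatic cycle containing both its ends.\<close>
  then have "card (g ` e) = 2"
    using proper_edge[OF g] e' by auto
  moreover have "card (g ` set C) = 2" "card (g ` set C') = 2"
    using C C' by (auto simp: bichromatic_cycles_def)
  ultimately have "g ` e = g ` set C" "g ` e = g ` set C'"
    using e'(2) sub by (metis card_subset_eq finite_imageI finite_set image_mono)+
  then show False
    using ne by simp
qed

text \<open>Weakly inside \<open>C'\<close>, the new colouring is the transposition applied to
  \<open>g\<close> on all of \<open>C\<close>, because common vertices have colours fixed by it.
  Weakly outside, nothing on \<open>C\<close> changes.\<close>

lemma card_swap_inside_not_split:
  assumes C': "is_cycle G C'" and C: "is_cycle G C" and card: "card (g ` set C) = 2"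
    and st: "{s, t} \<inter> g ` set C' = {}"
    and weak: "cycle_image \<Phi> C \<subseteq> inside (cycle_image \<Phi> C') \<union> cycle_image \<Phi> C' \<or>
      cycle_image \<Phi> C \<subseteq> outside (cycle_image \<Phi> C') \<union> cycle_image \<Phi> C'"
  shows "card (swap_inside G \<Phi> C' s t g ` set C) = 2"
proof -
  let ?J = "cycle_image \<Phi> C'" and ?h = "swap_inside G \<Phi> C' s t g"
  let ?p = "Transposition.transpose s t"
  have pos: "pos \<Phi> v \<in> cycle_image \<Phi> C" "v \<in> verts G" if "v \<in> set C" for v
    using that pos_on_cycle[OF C] C by (auto simp: is_cycle_def)
  from weak show ?thesis
  proof
    assume sub: "cycle_image \<Phi> C \<subseteq> inside ?J \<union> ?J"
    have "?h v = ?p (g v)" if v: "v \<in> set C" for v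
    proof (cases "v \<in> set C'")
      case True
      then show ?thesis
        using swap_inside_eq[OF C' st] by simp
    next
      case False
      then have "v \<in> interior_verts G \<Phi> C'"
        using sub pos[OF v] pos_on_cycle[OF C'] by (auto simp: interior_verts_iff)
      then show ?thesis
        by (simp add: swap_inside_def)
    qed
    then have "?h ` set C = ?p ` g ` set C"
      by (auto simp: image_iff)
    then show ?thesis
      using card by (simp add: card_image)
  next
    assume sub: "cycle_image \<Phi> C \<subseteq> outside ?J \<union> ?J"
    have "?h v = g v" if v: "v \<in> set C" for v
    proof -
      have "v \<notin> interior_verts G \<Phi> C'"
        using sub pos[OF v] jordan_curve_sides(9,10)[OF cycle_jordan_curve[OF C']]
          interior_verts_iff by blast
      then show ?thesis
        by (simp add: swap_inside_def)
    qed
    then have "?h ` set C = g ` set C"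
      by (auto simp: image_iff)
    then show ?thesis
      using card by simp
  qed
qed

lemma weakly_inside_of_card_swap_inside:
  assumes g: "g \<in> proper_colourings G colours"
    and C: "C \<in> bichromatic_cycles G g" and C': "C' \<in> bichromatic_cycles G g"
    and ne: "g ` set C \<noteq> g ` set C'" and st: "{s, t} = colours - g ` set C'"
    and card: "card (swap_inside G \<Phi> C' s t g ` set C) = 2"
    and a: "a \<in> set C" "a \<in> interior_verts G \<Phi> C'"
  shows "cycle_image \<Phi> C \<subseteq> inside (cycle_image \<Phi> C') \<union> cycle_image \<Phi> C'"
proof -
  let ?J = "cycle_image \<Phi> C" and ?J' = "cycle_image \<Phi> C'" and ?h = "swap_inside G \<Phi> C' s t g"
  let ?I = "interior_verts G \<Phi> C'"
  have cyc: "is_cycle G C" "is_cycle G C'"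
    using C C' by (auto simp: bichromatic_cycles_def)
  have cV: "v \<in> verts G" if "v \<in> set C" for v
    using that cyc by (auto simp: is_cycle_def)
  have edge: "{v, w} \<in> edges G" if "{v, w} \<in> cycle_edges C" for v w
    using that cyc by (auto simp: is_cycle_def)
  have dis: "{s, t} \<inter> g ` set C' = {}"
    using st by auto
  have leaves: "\<not> e \<subseteq> set C'" if "e \<in> cycle_edges C" for e
    using edge_leaves_cycle[OF g C C' ne that] .
  have J': "jordan_curve ?J'"
    by (rule cycle_jordan_curve[OF cyc(2)])
  show ?thesis
  \<comment> \<open>Without a common vertex the colour sets may be complementary; then the swap
    merely permutes the colours of \<open>C\<close> and counting colours says nothing, so topology
    decides. With a common vertex the cycles share exactly one colour, and counting works.\<close>
  proof (cases "set C \<inter> set C' = {}")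
    case True
    have "path_image (curve \<Phi> e) \<inter> ?J' = {}" if e: "e \<in> cycle_edges C" for e
    proof -
      have "e \<in> edges G" "e \<subseteq> set C"
        using e cyc cycle_edge_subset by (auto simp: is_cycle_def)
      moreover have "e \<notin> cycle_edges C'"
        using leaves[OF e] cycle_edge_subset by blast
      ultimately show ?thesis
        using curve_Int_cycle_image[OF cyc(2), of e] True by blast
    qed
    then have "?J \<inter> ?J' = {}"
      by (auto simp: cycle_image_def)
    then have "?J \<subseteq> inside ?J' \<or> ?J \<subseteq> outside ?J'"
      using connected_one_side[OF J'] jordan_curve_sides(2)[OF cycle_jordan_curve[OF cyc(1)]]
      by blast
    moreover have "pos \<Phi> a \<in> ?J" "pos \<Phi> a \<in> inside ?J'"
      using a pos_on_cycle[OF cyc(1)] cV by (auto simp: interior_verts_def)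
    ultimately show ?thesis
      using jordan_curve_sides(9)[OF J'] by blast
  next
    case False
    then obtain x where x: "x \<in> set C" "x \<in> set C'"
      by auto
    have card_C: "card (g ` set C) = 2" and card_C': "card (g ` set C') = 2"
      using C C' by (auto simp: bichromatic_cycles_def)
    have "card (g ` set C - {g x}) = 1"
      using card_C x(1) by simp
    \<comment> \<open>\<open>c\<close> is the colour of \<open>C\<close> that \<open>C'\<close>
      lacks: it is one of \<open>s\<close>, \<open>t\<close>, and vertices coloured \<open>c\<close>
      lie off \<open>C'\<close>.\<close>
    then obtain c where "g ` set C - {g x} = {c}"
      by (auto simp: card_1_singleton_iff)
    then have c: "g ` set C = {g x, c}" "c \<noteq> g x"
      using x(1) by auto
    have "c \<notin> g ` set C'"
    proof
      assume "c \<in> g ` set C'"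
      then have "g ` set C \<subseteq> g ` set C'"
        using c x(2) by auto
      then show False
        using card_subset_eq[of "g ` set C'" "g ` set C"] card_C card_C' ne by simp
    qed
    then have off: "v \<notin> set C'" if "g v = c" for v
      using that by auto
    have "c \<in> g ` set C"
      using c by auto
    then have "c \<in> colours"
      using g cV by (auto simp: proper_colourings_def PiE_iff)
    then have cst: "c \<in> {s, t}"
      using st \<open>c \<notin> g ` set C'\<close> by auto
    have "card (colours - g ` set C') = 2"
    proof -
      have "g ` set C' \<subseteq> colours"
        using g cyc by (auto simp: proper_colourings_def PiE_iff is_cycle_def)
      then show ?thesis
        using C' by (subst card_Diff_subset) (auto simp: bichromatic_cycles_def colours_def)
    qed
    then have "s \<noteq> t"
      using st by (auto simp: card_2_iff doubleton_eq_iff)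
    \<comment> \<open>The side of a vertex of \<open>C\<close> off \<open>C'\<close> can be read off
      at a vertex coloured \<open>c\<close>: if it is not coloured \<open>c\<close> itself, its
      neighbour along \<open>C\<close> is, and the edge between them has both ends off
      \<open>C'\<close>.\<close>
    have neighbour: "\<exists>w\<in>set C. g w = c \<and> (v \<in> ?I \<longleftrightarrow> w \<in> ?I)"
      if v: "v \<in> set C" "v \<notin> set C'" for v
    proof (cases "g v = c")
      case True
      then show ?thesis using v by auto
    next
      case False
      obtain w where w: "{v, w} \<in> cycle_edges C" "w \<in> set C"
        using in_cycle_edge[OF v(1)] by auto
      have "g w \<noteq> g v"
        using proper_edge[OF g edge[OF w(1)]] by simp
      moreover have "g v \<in> {g x, c}" "g w \<in> {g x, c}"
        using v(1) w(2) c(1) by blast+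
      ultimately have "g w = c"
        using False by auto
      then show ?thesis
        using interior_edge[OF cyc(2) edge[OF w(1)]] v(2) w(2) off by auto
    qed
    obtain w where w: "w \<in> set C" "g w = c" "w \<in> ?I"
      using neighbour[OF a(1)] a(2) interior_vert_not_on_cycle[OF cyc(2)] by auto
    have "v \<in> ?I" if v: "v \<in> set C" "v \<notin> set C'" for v
    proof (rule ccontr)
      assume "v \<notin> ?I"
      then obtain u where u: "u \<in> set C" "g u = c" "u \<notin> ?I"
        using neighbour[OF v] by auto
      \<comment> \<open>Three colours appear on \<open>C\<close>: \<open>c\<close> survives outside
        at \<open>u\<close>, becomes the other of \<open>s\<close>, \<open>t\<close> inside at
        \<open>w\<close>, and \<open>x\<close> keeps a colour different from both.\<close>
      have "?h u = c" "?h w = Transposition.transpose s t c" "?h x = g x"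
        using u w swap_inside_eq(1)[OF cyc(2) dis x(2)] by (auto simp: swap_inside_def)
      moreover have "g x \<notin> {s, t}"
        using dis x by auto
      ultimately have "card {?h u, ?h w, ?h x} = 3"
        using cst \<open>s \<noteq> t\<close> by (auto simp: Transposition.transpose_def)
      moreover have "card {?h u, ?h w, ?h x} \<le> card (?h ` set C)"
        using u w x by (intro card_mono) auto
      ultimately show False
        using card by simp
    qed
    then have "pos \<Phi> v \<in> inside ?J' \<union> ?J'" if "v \<in> set C" for v
      using that pos_on_cycle[OF cyc(2) cV[OF that]] interior_verts_iff[OF cV[OF that]] by auto
    then show ?thesis
      using cycle_weakly_one_side[OF cyc leaves, where S = inside] by auto
  qed
qed

text \<open>Both colour sets are taken under the same \<open>f'\<close>, since the Kempe class is
  closed under renaming and colour names under \<open>f\<close> and \<open>f'\<close> are not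
  comparable.\<close>

lemma UB_cycle_iff:
  assumes f: "f \<in> proper_colourings G colours" and C: "C \<in> bichromatic_cycles G f"
  shows "UB_cycle G \<Phi> f C \<longleftrightarrow>
    (\<forall>f'\<in>kempe_class G \<Phi> f. \<forall>C'\<in>bichromatic_cycles G f'.
       f' ` set C' \<noteq> f' ` set C \<longrightarrow> \<not> intersecting G \<Phi> C C')"
    (is "_ \<longleftrightarrow> ?nonint")
proof
  assume UB: "UB_cycle G \<Phi> f C"
  show ?nonint
  proof (intro ballI impI notI)
    fix g C'
    assume g: "g \<in> kempe_class G \<Phi> f" and C': "C' \<in> bichromatic_cycles G g"
      and ne: "g ` set C' \<noteq> g ` set C" and int: "intersecting G \<Phi> C C'"
    have proper: "g \<in> proper_colourings G colours"
      by (rule kempe_class_proper[OF f g])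
    have cyc: "is_cycle G C" "is_cycle G C'"
      using C C' by (auto simp: bichromatic_cycles_def)
    have "g ` set C' \<subseteq> colours"
      using proper cyc by (auto simp: proper_colourings_def PiE_iff is_cycle_def)
    then have "card (colours - g ` set C') = 2"
      using C' by (subst card_Diff_subset) (auto simp: bichromatic_cycles_def colours_def)
    then obtain s t where st: "{s, t} = colours - g ` set C'"
      by (metis card_2_iff)
    have "swap_inside G \<Phi> C' s t g \<in> kempe_class G \<Phi> f"
      using kempe_class.sigma[OF g C' st] .
    then have "card (swap_inside G \<Phi> C' s t g ` set C) = 2"
      using UB by (auto simp: UB_cycle_def)
    moreover have "C \<in> bichromatic_cycles G g"
      using UB g cyc by (auto simp: UB_cycle_def bichromatic_cycles_def)
    \<comment> \<open>One half of \<open>intersecting\<close> supplies the vertex of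
      \<open>C\<close> inside \<open>C'\<close> needed here; the other half, a vertex of
      \<open>C'\<close> inside \<open>C\<close>, then gives the contradiction.\<close>
    ultimately have "cycle_image \<Phi> C \<subseteq> inside (cycle_image \<Phi> C') \<union> cycle_image \<Phi> C'"
      using weakly_inside_of_card_swap_inside[OF proper _ C' ne[symmetric] st] int
      unfolding intersecting_def by blast
    then have "cycle_image \<Phi> C' \<inter> inside (cycle_image \<Phi> C) = {}"
      using weakly_inside_disjoint_inside cyc cycle_jordan_curve by blast
    moreover obtain b where "b \<in> set C'" "b \<in> interior_verts G \<Phi> C"
      using int by (auto simp: intersecting_def)
    ultimately show False
      using pos_on_cycle[OF cyc(2), of b] by (auto simp: interior_verts_def)
  qed
next
  assume nonint: ?nonint
  have cyc: "is_cycle G C"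
    using C by (auto simp: bichromatic_cycles_def)
  have "card (g ` set C) = 2" if "g \<in> kempe_class G \<Phi> f" for g
    using that
  proof induction
    case base
    then show ?case
      using C by (auto simp: bichromatic_cycles_def)
  next
    case (sigma g C' s t)
    have cyc': "is_cycle G C'"
      using sigma by (auto simp: bichromatic_cycles_def)
    have proper: "g \<in> proper_colourings G colours"
      by (rule kempe_class_proper[OF f sigma(1)])
    have Cg: "C \<in> bichromatic_cycles G g"
      using cyc sigma by (auto simp: bichromatic_cycles_def)
    have dis: "{s, t} \<inter> g ` set C' = {}"
      using sigma by auto
    consider "g ` set C' = g ` set C" | "set C \<inter> interior_verts G \<Phi> C' = {}"
      | "g ` set C' \<noteq> g ` set C" "set C' \<inter> interior_verts G \<Phi> C = {}"
      using nonint sigma unfolding intersecting_def by blast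
    then show ?case
    proof cases
      case 1
      \<comment> \<open>With equal colour sets, neither swapped colour occurs on
        \<open>C\<close>.\<close>
      then have "g v \<notin> {s, t}" if "v \<in> set C" for v
        using dis that by blast
      then have "swap_inside G \<Phi> C' s t g v = g v" if "v \<in> set C" for v
        using that by (auto simp: swap_inside_def Transposition.transpose_def)
      then show ?thesis
        using sigma.IH by (metis image_cong)
    next
      case 2
      then have "swap_inside G \<Phi> C' s t g v = g v" if "v \<in> set C" for v
        using that by (auto simp: swap_inside_def)
      then show ?thesis
        using sigma.IH by (metis image_cong)
    next
      case 3
      note s = jordan_curve_sides[OF cycle_jordan_curve[OF cyc]]
      have "pos \<Phi> v \<in> outside (cycle_image \<Phi> C) \<union> cycle_image \<Phi> C" if "v \<in> set C'" for v
      proof -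
        have "v \<in> verts G"
          using that cyc' by (auto simp: is_cycle_def)
        then have "pos \<Phi> v \<notin> inside (cycle_image \<Phi> C)"
          using 3(2) that interior_verts_iff by auto
        then show ?thesis
          using s(10) by blast
      qed
      \<comment> \<open>The roles are exchanged: edges of \<open>C'\<close> leave \<open>C\<close>,
        so the whole curve of \<open>C'\<close> is weakly outside \<open>C\<close>. Therefore
        \<open>C'\<close> does not split \<open>C\<close>.\<close>
      then have "cycle_image \<Phi> C' \<subseteq> outside (cycle_image \<Phi> C) \<union> cycle_image \<Phi> C"
        using edge_leaves_cycle[OF proper sigma(2) Cg 3(1)]
        by (intro cycle_weakly_one_side[OF cyc' cyc]) auto
      then show ?thesis
        using weakly_outside_one_side cycle_jordan_curve cyc cyc' sigma.IH dis
        by (intro card_swap_inside_not_split) auto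
    qed
  next
    case (rename g p)
    have "restrict (p \<circ> g) (verts G) ` set C = p ` g ` set C"
      using cyc by (auto simp: is_cycle_def image_iff)
    then show ?case
      using rename card_image[of p "g ` set C"] permutes_inj_on by metis
  qed
  then show "UB_cycle G \<Phi> f C"
    using C by (auto simp: UB_cycle_def)
qed

end

theorem theorem1:
  fixes G :: "'a ugraph" and \<Phi> :: "'a drawing" and f :: "'a \<Rightarrow> nat" and C :: "'a list"
  assumes "maximal_planar G"
    and "plane_embedding G \<Phi>"
    and "chromatic_number G = 4"
    and "min_degree G \<ge> 4"
    and "f \<in> proper_colourings G colours"
    and "C \<in> bichromatic_cycles G f"
  shows "UB_cycle G \<Phi> f C \<longleftrightarrow>
    (\<forall>f'\<in>kempe_class G \<Phi> f. \<forall>C'\<in>bichromatic_cycles G f'.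
       f' ` set C' \<noteq> f' ` set C \<longrightarrow> \<not> intersecting G \<Phi> C C')"
proof -
  \<comment> \<open>Planarity supplies \<open>simple_graph G\<close>; the embedding is the given
    \<open>\<Phi>\<close>, not the witness inside \<open>planar\<close>.\<close>
  interpret embedded_graph G \<Phi>
    using assms(1,2) by unfold_locales (auto simp: maximal_planar_def planar_def)
  show ?thesis
    using UB_cycle_iff assms(5,6) .
qed

end
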